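(* Let $\Bbbk$ be a field, $A$ a $\Bbbk$-algebra, and $M$ a finitely generated projective left $A$-module with finite dual basis $\omega_i\in M$, $\eta_i\in {}_A\mathrm{Hom}(M,A)$, $i=1,\ldots,n$ (so $m=\sum_i\eta_i(m)\omega_i$ for all $m\in M$). Let $\pi=(\pi_{ij})\in M_n(A)$, $\pi_{ij}=\eta_j(\omega_i)$, be the idempotent associated to this dual basis. Assume that there exist $\Bbbk$-linear maps $\sigma,\tilde\sigma:A\to M_n(A)$ such that $(\pi,\sigma,\tilde\sigma)$ is a pre-projective system on $A$. Then: (1) $M$ is an $A$-bimodule with its given left action and the right multiplication $$ma:=\sum_{i,j}\eta_i(m)\,\tilde\sigma_{ij}(a)\,\omega_j=\sum_{i,j}\eta_i(m)\,\sigma_{ij}(a)\,\omega_j,\qquad a\in A,\ m\in M.$$ In particular, for all $a\in A$ and $i=1,\ldots,n$, $$\omega_i a=\sum_j\sigma_{ij}(a)\,\omega_j=\sum_j\tilde\sigma_{ij}(a)\,\omega_j.$$ (2) If there exists an algebra map $\bar\sigma:A\to M_n(A)$ such that $(\pi,\sigma,\tilde\sigma;\bar\sigma)$ is a projective system, then $$a\omega_i=\sum_j\omega_j\,\bar\sigma_{ji}(a)\qquad\text{for all } a\in A,\ i=1,\ldots,n,$$ and $M$ is a finitely generated and projective right $A$-module.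
   Context: All algebras are associative and unital over the field $\Bbbk$; $M_n(A)$ is the algebra of $n\times n$ matrices over $A$; ${}_A\mathrm{Hom}(M,A)$ denotes left $A$-module maps. For a map $\sigma:A\to M_n(A)$ write $\sigma(a)=(\sigma_{ij}(a))_{i,j}$. A triple $(\pi,\sigma,\tilde\sigma)$ with $\pi\in M_n(A)$ idempotent and $\sigma,\tilde\sigma:A\to M_n(A)$ $\Bbbk$-linear is a pre-projective system on $A$ if, for all $a,b\in A$, in $M_n(A)$: $$\tilde\sigma(b)\sigma(a)\pi=\tilde\sigma(ba)\pi,\qquad \tilde\sigma(1)=\pi,\qquad \sigma(a)\pi=\pi\tilde\sigma(a).$$ A projective system $(\pi,\sigma,\tilde\sigma;\bar\sigma)$ is a pre-projective system $(\pi,\sigma,\tilde\sigma)$ together with an algebra map $\bar\sigma:A\to M_n(A)$ such that, for all $a\in A$ and all $i,j$, $$\sum_k\bar\sigma_{ik}(\tilde\sigma_{jk}(a))=\delta_{ij}\,a,\qquad \sum_k\sigma_{kj}(\bar\sigma_{ki}(a))=a\,\pi_{ij}.$$ *)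

theory Defs
  imports "Jordan_Normal_Form.Matrix"
begin

text \<open>
  Rings are types of sort \<open>{ring, monoid_mult}\<close>: associative and unital, with the zero ring
  allowed (class \<open>ring_1\<close> would add the axiom \<open>0 \<noteq> 1\<close>).  The matrix ring over \<open>A\<close> is
  \<open>carrier_mat n n\<close>; indices run over \<open>0, \<dots>, n - 1\<close>.
\<close>

locale assoc_algebra = vector_space scale
  for scale :: "'k::field \<Rightarrow> 'a::{ring, monoid_mult} \<Rightarrow> 'a" +
  assumes scale_mult_left: "scale c (a * b) = scale c a * b"
    and scale_mult_right: "scale c (a * b) = a * scale c b"

locale left_module =
  fixes lact :: "'a::{ring, monoid_mult} \<Rightarrow> 'm::ab_group_add \<Rightarrow> 'm"
  assumes lact_add_right: "lact a (x + y) = lact a x + lact a y"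
    and lact_add_left: "lact (a + b) x = lact a x + lact b x"
    and lact_mult: "lact (a * b) x = lact a (lact b x)"
    and lact_one: "lact 1 x = x"

locale right_module =
  fixes ract :: "'m::ab_group_add \<Rightarrow> 'a::{ring, monoid_mult} \<Rightarrow> 'm"
  assumes ract_add_left: "ract (x + y) a = ract x a + ract y a"
    and ract_add_right: "ract x (a + b) = ract x a + ract x b"
    and ract_mult: "ract x (a * b) = ract (ract x a) b"
    and ract_one: "ract x 1 = x"

text \<open>
  Bimodules over a \<open>k\<close>-algebra: the two vector space structures on \<open>M\<close> induced by the two
  actions have to agree.
\<close>

locale bimodule = left_module lact + right_module ract
  for scale :: "'k::field \<Rightarrow> 'a::{ring, monoid_mult} \<Rightarrow> 'a"
    and lact :: "'a \<Rightarrow> 'm::ab_group_add \<Rightarrow> 'm"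
    and ract :: "'m \<Rightarrow> 'a \<Rightarrow> 'm" +
  assumes act_assoc: "ract (lact a x) b = lact a (ract x b)"
    and scalars_central: "lact (scale c 1) x = ract x (scale c 1)"

definition left_module_hom ::
  "('a \<Rightarrow> 'x::ab_group_add \<Rightarrow> 'x) \<Rightarrow> ('a \<Rightarrow> 'y::ab_group_add \<Rightarrow> 'y) \<Rightarrow> ('x \<Rightarrow> 'y) \<Rightarrow> bool" where
  "left_module_hom lx ly f \<longleftrightarrow>
     (\<forall>x x'. f (x + x') = f x + f x') \<and> (\<forall>a x. f (lx a x) = ly a (f x))"

definition right_module_hom ::
  "('x::ab_group_add \<Rightarrow> 'a \<Rightarrow> 'x) \<Rightarrow> ('y::ab_group_add \<Rightarrow> 'a \<Rightarrow> 'y) \<Rightarrow> ('x \<Rightarrow> 'y) \<Rightarrow> bool" where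
  "right_module_hom rx ry f \<longleftrightarrow>
     (\<forall>x x'. f (x + x') = f x + f x') \<and> (\<forall>x a. f (rx x a) = ry (f x) a)"

definition left_finitely_generated ::
  "('a::{ring, monoid_mult} \<Rightarrow> 'm::ab_group_add \<Rightarrow> 'm) \<Rightarrow> bool" where
  "left_finitely_generated lact \<longleftrightarrow> (\<exists>S. finite S \<and> (\<forall>m. \<exists>c. m = (\<Sum>s\<in>S. lact (c s) s)))"

definition right_finitely_generated ::
  "('m::ab_group_add \<Rightarrow> 'a::{ring, monoid_mult} \<Rightarrow> 'm) \<Rightarrow> bool" where
  "right_finitely_generated ract \<longleftrightarrow> (\<exists>S. finite S \<and> (\<forall>m. \<exists>c. m = (\<Sum>s\<in>S. ract s (c s))))"

text \<open>
  Projectivity is the lifting property against surjections \<open>g : X \<rightarrow> Y\<close>.  HOL cannot quantify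
  over types inside a formula, so the types carrying \<open>X\<close> and \<open>Y\<close> are parameters; a theorem
  concluding projectivity with \<open>'x\<close> and \<open>'y\<close> free asserts lifting against all modules.
\<close>

definition left_projective ::
  "'x::ab_group_add itself \<Rightarrow> 'y::ab_group_add itself \<Rightarrow>
   ('a::{ring, monoid_mult} \<Rightarrow> 'm::ab_group_add \<Rightarrow> 'm) \<Rightarrow> bool" where
  "left_projective TX TY lact \<longleftrightarrow>
     (\<forall>(lx :: 'a \<Rightarrow> 'x \<Rightarrow> 'x) (ly :: 'a \<Rightarrow> 'y \<Rightarrow> 'y) g f.
        left_module lx \<longrightarrow> left_module ly \<longrightarrow>
        left_module_hom lx ly g \<longrightarrow> surj g \<longrightarrow> left_module_hom lact ly f \<longrightarrow>
        (\<exists>h. left_module_hom lact lx h \<and> g \<circ> h = f))"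

definition right_projective ::
  "'x::ab_group_add itself \<Rightarrow> 'y::ab_group_add itself \<Rightarrow>
   ('m::ab_group_add \<Rightarrow> 'a::{ring, monoid_mult} \<Rightarrow> 'm) \<Rightarrow> bool" where
  "right_projective TX TY ract \<longleftrightarrow>
     (\<forall>(rx :: 'x \<Rightarrow> 'a \<Rightarrow> 'x) (ry :: 'y \<Rightarrow> 'a \<Rightarrow> 'y) g f.
        right_module rx \<longrightarrow> right_module ry \<longrightarrow>
        right_module_hom rx ry g \<longrightarrow> surj g \<longrightarrow> right_module_hom ract ry f \<longrightarrow>
        (\<exists>h. right_module_hom ract rx h \<and> g \<circ> h = f))"

definition finite_dual_basis ::
  "('a::{ring, monoid_mult} \<Rightarrow> 'm::ab_group_add \<Rightarrow> 'm) \<Rightarrow> nat \<Rightarrow> (nat \<Rightarrow> 'm) \<Rightarrow> (nat \<Rightarrow> 'm \<Rightarrow> 'a) \<Rightarrow> bool"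
  where
  "finite_dual_basis lact n \<omega> \<eta> \<longleftrightarrow>
     (\<forall>i<n. left_module_hom lact (*) (\<eta> i)) \<and>
     (\<forall>m. m = (\<Sum>i<n. lact (\<eta> i m) (\<omega> i)))"

text \<open>
  A left module with a finite dual basis is finitely generated and projective, so a separate
  hypothesis to that effect would be redundant.
\<close>

lemma (in left_module) finite_dual_basis_imp_fg_projective:
  assumes db: "finite_dual_basis lact n \<omega> \<eta>"
  shows "left_finitely_generated lact"
    and "left_projective TYPE('x::ab_group_add) TYPE('y::ab_group_add) lact"
proof -
  have zero: "lact 0 x = 0" for x
    using lact_add_left[of 0 0 x] by simp
  have sum_l: "lact (\<Sum>i\<in>I. u i) x = (\<Sum>i\<in>I. lact (u i) x)" if "finite I"
    for u :: "nat \<Rightarrow> 'a" and x I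
    using that by (induction I) (auto simp: zero lact_add_left)
  have exp: "m = (\<Sum>i<n. lact (\<eta> i m) (\<omega> i))" for m
    using db unfolding finite_dual_basis_def by blast
  show "left_finitely_generated lact"
    unfolding left_finitely_generated_def
  proof (intro exI[of _ "\<omega> ` {..<n}"] conjI allI)
    fix m
    have "m = (\<Sum>s\<in>\<omega> ` {..<n}. \<Sum>i\<in>{i\<in>{..<n}. \<omega> i = s}. lact (\<eta> i m) (\<omega> i))"
      using exp[of m] by (subst sum.image_gen[symmetric]) auto
    also have "\<dots> = (\<Sum>s\<in>\<omega> ` {..<n}. lact (\<Sum>i\<in>{i\<in>{..<n}. \<omega> i = s}. \<eta> i m) s)"
      by (intro sum.cong refl) (simp add: sum_l)
    finally show "\<exists>c. m = (\<Sum>s\<in>\<omega> ` {..<n}. lact (c s) s)"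
      by (intro exI[of _ "\<lambda>s. \<Sum>i\<in>{i\<in>{..<n}. \<omega> i = s}. \<eta> i m"])
  qed auto
  show "left_projective TYPE('x::ab_group_add) TYPE('y::ab_group_add) lact"
    unfolding left_projective_def
  proof (intro allI impI)
    fix lx :: "'a \<Rightarrow> 'x \<Rightarrow> 'x" and ly :: "'a \<Rightarrow> 'y \<Rightarrow> 'y" and g f
    assume lx: "left_module lx" and g: "left_module_hom lx ly g" and "surj g"
      and f: "left_module_hom lact ly f"
    define x where "x i = inv_into UNIV g (f (\<omega> i))" for i
    have gx: "g (x i) = f (\<omega> i)" for i
      using \<open>surj g\<close> by (simp add: x_def surj_f_inv_f)
    have lx0: "lx a 0 = 0" for a
      using left_module.lact_add_right[OF lx, of a 0 0] by simp
    have lx_sum: "lx a (\<Sum>i<k. v i) = (\<Sum>i<k. lx a (v i))" for a v and k :: nat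
      by (induction k) (auto simp: lx0 left_module.lact_add_right[OF lx])
    have g_sum: "g (\<Sum>i<k. v i) = (\<Sum>i<k. g (v i))" for v and k :: nat
    proof -
      have add: "g (u + w) = g u + g w" for u w
        using g by (auto simp: left_module_hom_def)
      have "g 0 = 0" using add[of 0 0] by simp
      then show ?thesis by (induction k) (auto simp: add)
    qed
    have f_sum: "f (\<Sum>i<k. v i) = (\<Sum>i<k. f (v i))" for v and k :: nat
    proof -
      have add: "f (u + w) = f u + f w" for u w
        using f by (auto simp: left_module_hom_def)
      have "f 0 = 0" using add[of 0 0] by simp
      then show ?thesis by (induction k) (auto simp: add)
    qed
    define h where "h m = (\<Sum>i<n. lx (\<eta> i m) (x i))" for m
    have \<eta>: "\<eta> i (m + m') = \<eta> i m + \<eta> i m'" "\<eta> i (lact a m) = a * \<eta> i m" if "i < n" for i m m' a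
      using db that by (auto simp: finite_dual_basis_def left_module_hom_def)
    have "left_module_hom lact lx h"
      by (auto simp: left_module_hom_def h_def \<eta> lx_sum left_module.lact_add_left[OF lx]
          left_module.lact_mult[OF lx] sum.distrib)
    moreover have "g (h m) = f m" for m
    proof -
      have "g (h m) = (\<Sum>i<n. ly (\<eta> i m) (f (\<omega> i)))"
        using g by (simp add: h_def g_sum left_module_hom_def gx)
      also have "\<dots> = f (\<Sum>i<n. lact (\<eta> i m) (\<omega> i))"
        using f by (simp add: f_sum left_module_hom_def)
      finally show ?thesis using exp[of m] by simp
    qed
    ultimately show "\<exists>h. left_module_hom lact lx h \<and> g \<circ> h = f"
      by (auto simp: fun_eq_iff)
  qed
qed

definition dual_basis_idempotent ::
  "nat \<Rightarrow> (nat \<Rightarrow> 'm) \<Rightarrow> (nat \<Rightarrow> 'm \<Rightarrow> 'a) \<Rightarrow> 'a mat" where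
  "dual_basis_idempotent n \<omega> \<eta> = mat n n (\<lambda>(i, j). \<eta> j (\<omega> i))"

definition linear_to_mat ::
  "('k::field \<Rightarrow> 'a::{ring, monoid_mult} \<Rightarrow> 'a) \<Rightarrow> nat \<Rightarrow> ('a \<Rightarrow> 'a mat) \<Rightarrow> bool" where
  "linear_to_mat scale n \<sigma> \<longleftrightarrow>
     (\<forall>a. \<sigma> a \<in> carrier_mat n n) \<and>
     (\<forall>a b. \<sigma> (a + b) = \<sigma> a + \<sigma> b) \<and>
     (\<forall>c a. \<sigma> (scale c a) = map_mat (scale c) (\<sigma> a))"

definition algebra_map_to_mat ::
  "('k::field \<Rightarrow> 'a::{ring, monoid_mult} \<Rightarrow> 'a) \<Rightarrow> nat \<Rightarrow> ('a \<Rightarrow> 'a mat) \<Rightarrow> bool" where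
  "algebra_map_to_mat scale n \<sigma> \<longleftrightarrow>
     linear_to_mat scale n \<sigma> \<and>
     (\<forall>a b. \<sigma> (a * b) = \<sigma> a * \<sigma> b) \<and>
     \<sigma> 1 = 1\<^sub>m n"

definition pre_projective_system ::
  "('k::field \<Rightarrow> 'a::{ring, monoid_mult} \<Rightarrow> 'a) \<Rightarrow> nat \<Rightarrow>
   'a mat \<Rightarrow> ('a \<Rightarrow> 'a mat) \<Rightarrow> ('a \<Rightarrow> 'a mat) \<Rightarrow> bool" where
  "pre_projective_system scale n \<pi> \<sigma> \<sigma>t \<longleftrightarrow>
     \<pi> \<in> carrier_mat n n \<and> \<pi> * \<pi> = \<pi> \<and>
     linear_to_mat scale n \<sigma> \<and> linear_to_mat scale n \<sigma>t \<and>
     (\<forall>a b. \<sigma>t b * \<sigma> a * \<pi> = \<sigma>t (b * a) * \<pi>) \<and>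
     \<sigma>t 1 = \<pi> \<and>
     (\<forall>a. \<sigma> a * \<pi> = \<pi> * \<sigma>t a)"

definition projective_system ::
  "('k::field \<Rightarrow> 'a::{ring, monoid_mult} \<Rightarrow> 'a) \<Rightarrow> nat \<Rightarrow>
   'a mat \<Rightarrow> ('a \<Rightarrow> 'a mat) \<Rightarrow> ('a \<Rightarrow> 'a mat) \<Rightarrow> ('a \<Rightarrow> 'a mat) \<Rightarrow> bool" where
  "projective_system scale n \<pi> \<sigma> \<sigma>t \<sigma>b \<longleftrightarrow>
     pre_projective_system scale n \<pi> \<sigma> \<sigma>t \<and>
     algebra_map_to_mat scale n \<sigma>b \<and>
     (\<forall>a. \<forall>i<n. \<forall>j<n.
        (\<Sum>k<n. \<sigma>b (\<sigma>t a $$ (j, k)) $$ (i, k)) = (if i = j then a else 0)) \<and>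
     (\<forall>a. \<forall>i<n. \<forall>j<n.
        (\<Sum>k<n. \<sigma> (\<sigma>b a $$ (k, i)) $$ (k, j)) = a * \<pi> $$ (i, j))"

end

theory Submission
  imports Defs
begin

text \<open>
  A dual basis identifies \<open>M\<close> with the direct summand \<open>A\<^sup>n \<pi>\<close> of the left module of rows:
  \<open>m\<close> corresponds to its coordinate row \<open>(\<eta>\<^sub>1(m), \<dots>, \<eta>\<^sub>n(m))\<close>, and a row \<open>v\<close> represents
  \<open>\<Sum>\<^sub>j v\<^sub>j \<omega>\<^sub>j\<close>.  The element represented by \<open>v\<close> has coordinates \<open>v \<pi>\<close>, so \<open>v\<close> and \<open>v \<pi>\<close>
  represent the same element (\<open>of_row_mult_idempotent\<close>).  Hence the matrices \<open>P\<close> and \<open>P \<pi>\<close> act in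
  the same way once the result is read in \<open>M\<close>, and every equation \<open>P \<pi> = Q \<pi>\<close> between matrices
  turns into an equation in \<open>M\<close> (\<open>of_row_mult_cong\<close>).

  The right action is \<open>v \<mapsto> v \<sigma>t(a)\<close>.  Setting \<open>b = 1\<close> in
  \<open>\<sigma>t(b) \<sigma>(a) \<pi> = \<sigma>t(ba) \<pi>\<close> shows \<open>\<sigma>(a) \<pi> = \<pi> \<sigma>t(a) = \<sigma>t(a) \<pi>\<close> (\<open>\<sigma>t_idem\<close>), so
  the action may also be computed with \<open>\<sigma>(a)\<close>, and on \<open>\<omega>\<^sub>i\<close>, whose coordinates are row \<open>i\<close> of
  \<open>\<pi>\<close>, it yields the element represented by row \<open>i\<close> of either matrix.  Multiplicativity is
  \<open>\<sigma>t(a) \<pi> \<sigma>t(b) = \<sigma>t(a) \<sigma>(b) \<pi> = \<sigma>t(ab) \<pi>\<close>, and unitality is \<open>\<sigma>t(1) = \<pi>\<close>.  Because the action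
  multiplies rows on the right, it commutes with the left action.

  For a projective system, the second relation says that \<open>\<Sum>\<^sub>j \<omega>\<^sub>j \<sigma>b\<^sub>j\<^sub>i(a) = a \<omega>\<^sub>i\<close>.  Inserting
  \<open>a = \<eta>\<^sub>i(m)\<close> and summing over \<open>i\<close> gives \<open>m = \<Sum>\<^sub>j \<omega>\<^sub>j \<xi>\<^sub>j(m)\<close> with
  \<open>\<xi>\<^sub>j(m) = \<Sum>\<^sub>i \<sigma>b\<^sub>j\<^sub>i(\<eta>\<^sub>i(m))\<close>.  The first relation and the multiplicativity of \<open>\<sigma>b\<close> make each
  \<open>\<xi>\<^sub>j\<close> right linear (\<open>dual_coord_ract\<close>), so the \<open>\<omega>\<^sub>j\<close> and \<open>\<xi>\<^sub>j\<close> are a dual basis of \<open>M\<close> as a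
  right module, and finite generation and projectivity follow.
\<close>

section \<open>Right modules with a finite dual basis\<close>

lemma additive_sum:
  fixes f :: "'x::ab_group_add \<Rightarrow> 'y::ab_group_add"
  assumes add: "\<And>x y. f (x + y) = f x + f y"
  shows "f (\<Sum>i\<in>I. v i) = (\<Sum>i\<in>I. f (v i))"
proof -
  have "f 0 = 0" using add[of 0 0] by simp
  then show ?thesis by (induction I rule: infinite_finite_induct) (auto simp: add)
qed

context right_module
begin

lemma ract_sum_left: "ract (\<Sum>i\<in>I. u i) a = (\<Sum>i\<in>I. ract (u i) a)"
  by (rule additive_sum[of "\<lambda>x. ract x a"]) (rule ract_add_left)

lemma ract_sum_right: "ract x (\<Sum>i\<in>I. c i) = (\<Sum>i\<in>I. ract x (c i))"
  by (rule additive_sum) (rule ract_add_right)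

text \<open>
  The vectors \<open>\<omega> i\<close> may repeat, whereas finite generation speaks of a set of generators with one
  coefficient each; the coefficient of \<open>s\<close> is the sum over the fibre of \<open>\<omega>\<close> at \<open>s\<close>.
\<close>

lemma right_dual_basis_imp_finitely_generated:
  fixes n :: nat and \<omega> :: "nat \<Rightarrow> 'm"
  assumes expand: "\<And>m. m = (\<Sum>j<n. ract (\<omega> j) (\<xi> j m))"
  shows "right_finitely_generated ract"
  unfolding right_finitely_generated_def
proof (intro exI[of _ "\<omega> ` {..<n}"] conjI allI)
  fix m
  have "m = (\<Sum>s\<in>\<omega> ` {..<n}. \<Sum>j\<in>{j\<in>{..<n}. \<omega> j = s}. ract (\<omega> j) (\<xi> j m))"
    using expand[of m] by (subst sum.image_gen[symmetric]) auto
  also have "\<dots> = (\<Sum>s\<in>\<omega> ` {..<n}. ract s (\<Sum>j\<in>{j\<in>{..<n}. \<omega> j = s}. \<xi> j m))"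
    by (intro sum.cong refl) (simp add: ract_sum_right)
  finally show "\<exists>c. m = (\<Sum>s\<in>\<omega> ` {..<n}. ract s (c s))"
    by (intro exI[of _ "\<lambda>s. \<Sum>j\<in>{j\<in>{..<n}. \<omega> j = s}. \<xi> j m"])
qed auto

text \<open>
  To lift \<open>f\<close> along the surjection \<open>g\<close>, choose preimages \<open>x j\<close> of \<open>f (\<omega> j)\<close> and send \<open>m\<close> to
  \<open>\<Sum>\<^sub>j x\<^sub>j \<xi>\<^sub>j(m)\<close>.
\<close>

lemma right_dual_basis_imp_projective:
  fixes n :: nat and \<omega> :: "nat \<Rightarrow> 'm"
  assumes expand: "\<And>m. m = (\<Sum>j<n. ract (\<omega> j) (\<xi> j m))"
    and hom: "\<And>j. j < n \<Longrightarrow> right_module_hom ract (*) (\<xi> j)"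
  shows "right_projective TYPE('x::ab_group_add) TYPE('y::ab_group_add) ract"
  unfolding right_projective_def
proof (intro allI impI)
  fix rx :: "'x \<Rightarrow> 'a \<Rightarrow> 'x" and ry :: "'y \<Rightarrow> 'a \<Rightarrow> 'y" and g f
  assume "right_module rx" and g: "right_module_hom rx ry g" and surj: "surj g"
    and f: "right_module_hom ract ry f"
  interpret X: right_module rx by fact
  define x where "x j = inv_into UNIV g (f (\<omega> j))" for j
  have gx: "g (x j) = f (\<omega> j)" for j
    using surj by (simp add: x_def surj_f_inv_f)
  define h where "h m = (\<Sum>j<n. rx (x j) (\<xi> j m))" for m
  have "right_module_hom ract rx h"
    using hom
    by (auto simp: right_module_hom_def h_def X.ract_add_right X.ract_mult X.ract_sum_left
        sum.distrib)
  moreover have "g (h m) = f m" for m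
  proof -
    have g_add: "g (u + w) = g u + g w" for u w
      using g by (simp add: right_module_hom_def)
    have f_add: "f (u + w) = f u + f w" for u w
      using f by (simp add: right_module_hom_def)
    have "g (h m) = (\<Sum>j<n. ry (f (\<omega> j)) (\<xi> j m))"
      using g by (simp add: h_def additive_sum[of g, OF g_add] right_module_hom_def gx)
    also have "\<dots> = f (\<Sum>j<n. ract (\<omega> j) (\<xi> j m))"
      using f by (simp add: additive_sum[of f, OF f_add] right_module_hom_def)
    finally show ?thesis using expand[of m] by simp
  qed
  ultimately show "\<exists>h. right_module_hom ract rx h \<and> g \<circ> h = f"
    by (auto simp: fun_eq_iff)
qed

end

section \<open>Rows over the algebra\<close>

text \<open>
  Rows are functions on \<open>nat\<close> of which only the values below \<open>n\<close> matter; coordinate rows are then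
  simply \<open>\<lambda>i. \<eta> i m\<close>.
\<close>

definition row_mult :: "nat \<Rightarrow> (nat \<Rightarrow> 'a::semiring_0) \<Rightarrow> 'a mat \<Rightarrow> nat \<Rightarrow> 'a" where
  "row_mult n v P j = (\<Sum>i<n. v i * P $$ (i, j))"

lemma row_mult_add_left:
  "row_mult n (\<lambda>i. v i + w i) P j = row_mult n v P j + row_mult n w P j"
  by (simp add: row_mult_def distrib_right sum.distrib)

lemma row_mult_scale_left: "row_mult n (\<lambda>i. a * v i) P j = a * row_mult n v P j"
  by (simp add: row_mult_def mult.assoc sum_distrib_left)

lemma row_mult_add_right:
  assumes "P \<in> carrier_mat n n" "Q \<in> carrier_mat n n" "j < n"
  shows "row_mult n v (P + Q) j = row_mult n v P j + row_mult n v Q j"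
  using assms by (simp add: row_mult_def distrib_left sum.distrib)

lemma row_mult_cong: "(\<And>i. i < n \<Longrightarrow> v i = w i) \<Longrightarrow> row_mult n v P j = row_mult n w P j"
  by (simp add: row_mult_def)

lemma index_mult_mat_sum:
  assumes "P \<in> carrier_mat n n" "Q \<in> carrier_mat n n" "i < n" "j < n"
  shows "(P * Q) $$ (i, j) = (\<Sum>k<n. P $$ (i, k) * Q $$ (k, j))"
  using assms by (simp add: scalar_prod_def atLeast0LessThan)

lemma row_mult_assoc:
  assumes "P \<in> carrier_mat n n" "Q \<in> carrier_mat n n" "j < n"
  shows "row_mult n (row_mult n v P) Q j = row_mult n v (P * Q) j"
proof -
  have "row_mult n (row_mult n v P) Q j = (\<Sum>k<n. \<Sum>i<n. v i * (P $$ (i, k) * Q $$ (k, j)))"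
    by (simp add: row_mult_def sum_distrib_right mult.assoc)
  also have "\<dots> = (\<Sum>i<n. v i * (\<Sum>k<n. P $$ (i, k) * Q $$ (k, j)))"
    by (subst sum.swap) (simp add: sum_distrib_left)
  also have "\<dots> = row_mult n v (P * Q) j"
    using assms by (simp add: row_mult_def index_mult_mat_sum del: index_mult_mat)
  finally show ?thesis .
qed

section \<open>Elements of a module represented by rows\<close>

locale left_dual_basis = left_module lact
  for lact :: "'a::{ring, monoid_mult} \<Rightarrow> 'm::ab_group_add \<Rightarrow> 'm" +
  fixes n :: nat and \<omega> :: "nat \<Rightarrow> 'm" and \<eta> :: "nat \<Rightarrow> 'm \<Rightarrow> 'a"
  assumes dual_basis: "finite_dual_basis lact n \<omega> \<eta>"
begin

definition of_row :: "(nat \<Rightarrow> 'a) \<Rightarrow> 'm" where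
  "of_row v = (\<Sum>j<n. lact (v j) (\<omega> j))"

abbreviation coords :: "'m \<Rightarrow> nat \<Rightarrow> 'a" where
  "coords m \<equiv> (\<lambda>i. \<eta> i m)"

abbreviation idem :: "'a mat" where
  "idem \<equiv> dual_basis_idempotent n \<omega> \<eta>"

lemma idem_carrier: "idem \<in> carrier_mat n n"
  by (simp add: dual_basis_idempotent_def)

lemma coords_add: "i < n \<Longrightarrow> \<eta> i (x + y) = \<eta> i x + \<eta> i y"
  and coords_lact: "i < n \<Longrightarrow> \<eta> i (lact a x) = a * \<eta> i x"
  using dual_basis by (auto simp: finite_dual_basis_def left_module_hom_def)

lemma coords_sum: "i < n \<Longrightarrow> \<eta> i (\<Sum>k\<in>I. u k) = (\<Sum>k\<in>I. \<eta> i (u k))"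
  by (rule additive_sum) (rule coords_add)

lemma lact_sum_left: "lact (\<Sum>i\<in>I. c i) x = (\<Sum>i\<in>I. lact (c i) x)"
  by (rule additive_sum[of "\<lambda>a. lact a x"]) (rule lact_add_left)

lemma lact_sum_right: "lact a (\<Sum>i\<in>I. u i) = (\<Sum>i\<in>I. lact a (u i))"
  by (rule additive_sum) (rule lact_add_right)

lemma of_row_coords: "of_row (coords m) = m"
  using dual_basis by (simp add: of_row_def finite_dual_basis_def)

lemma of_row_cong: "(\<And>j. j < n \<Longrightarrow> v j = w j) \<Longrightarrow> of_row v = of_row w"
  by (simp add: of_row_def)

lemma of_row_add: "of_row (\<lambda>j. v j + w j) = of_row v + of_row w"
  by (simp add: of_row_def lact_add_left sum.distrib)

lemma of_row_scale: "of_row (\<lambda>j. a * v j) = lact a (of_row v)"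
  by (simp add: of_row_def lact_mult lact_sum_right)

lemma of_row_mult_expand:
  "of_row (row_mult n v P) = (\<Sum>i<n. \<Sum>j<n. lact (v i * P $$ (i, j)) (\<omega> j))"
  unfolding of_row_def row_mult_def lact_sum_left by (rule sum.swap)

lemma coords_of_row: "j < n \<Longrightarrow> \<eta> j (of_row v) = row_mult n v idem j"
  by (simp add: of_row_def row_mult_def coords_sum coords_lact dual_basis_idempotent_def)

lemma of_row_mult_idempotent: "of_row (row_mult n v idem) = of_row v"
proof -
  have "of_row (row_mult n v idem) = of_row (coords (of_row v))"
    by (rule of_row_cong) (simp add: coords_of_row)
  then show ?thesis by (simp add: of_row_coords)
qed

text \<open>
  Relations such as \<open>\<sigma>t(b) \<sigma>(a) \<pi> = \<sigma>t(ba) \<pi>\<close> determine matrices only up to right multiplication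
  by \<open>\<pi>\<close>; this is enough for an equation in \<open>M\<close>.
\<close>

lemma of_row_mult_cong:
  assumes "P \<in> carrier_mat n n" "Q \<in> carrier_mat n n" "P * idem = Q * idem"
  shows "of_row (row_mult n v P) = of_row (row_mult n v Q)"
proof -
  have "of_row (row_mult n v R) = of_row (row_mult n v (R * idem))"
    if "R \<in> carrier_mat n n" for R
    by (subst of_row_mult_idempotent[symmetric], rule of_row_cong)
      (simp add: row_mult_assoc that idem_carrier)
  then show ?thesis using assms by simp
qed

text \<open>
  Row \<open>i\<close> of \<open>\<pi>\<close> is the coordinate row of \<open>\<omega> i\<close>, so this evaluates matrix actions on the
  generators.
\<close>

lemma of_row_coords_generator:
  assumes "P \<in> carrier_mat n n" "i < n"
  shows "of_row (row_mult n (coords (\<omega> i)) P) = of_row (\<lambda>j. (idem * P) $$ (i, j))"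
proof (rule of_row_cong)
  fix j assume "j < n"
  with assms show "row_mult n (coords (\<omega> i)) P j = (idem * P) $$ (i, j)"
    unfolding index_mult_mat_sum[OF idem_carrier assms \<open>j < n\<close>]
    by (simp add: row_mult_def dual_basis_idempotent_def)
qed

lemma of_matrix_row_cong:
  assumes "P \<in> carrier_mat n n" "Q \<in> carrier_mat n n" "P * idem = Q * idem" "i < n"
  shows "of_row (\<lambda>j. P $$ (i, j)) = of_row (\<lambda>j. Q $$ (i, j))"
proof -
  have "of_row (\<lambda>j. R $$ (i, j)) = of_row (\<lambda>j. (R * idem) $$ (i, j))"
    if "R \<in> carrier_mat n n" for R
    using that assms(4)
    by (subst of_row_mult_idempotent[symmetric], intro of_row_cong)
      (simp add: row_mult_def index_mult_mat_sum[OF that idem_carrier] del: index_mult_mat)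
  then show ?thesis using assms by simp
qed

end

section \<open>The right action of a pre-projective system\<close>

locale pre_projective_module = left_dual_basis lact n \<omega> \<eta> + assoc_algebra scale
  for scale :: "'k::field \<Rightarrow> 'a::{ring, monoid_mult} \<Rightarrow> 'a"
    and lact :: "'a \<Rightarrow> 'm::ab_group_add \<Rightarrow> 'm"
    and n :: nat and \<omega> :: "nat \<Rightarrow> 'm" and \<eta> :: "nat \<Rightarrow> 'm \<Rightarrow> 'a" +
  fixes \<sigma> \<sigma>t :: "'a \<Rightarrow> 'a mat"
  assumes system: "pre_projective_system scale n (dual_basis_idempotent n \<omega> \<eta>) \<sigma> \<sigma>t"
begin

definition twisted_act :: "'m \<Rightarrow> 'a \<Rightarrow> 'm" where
  "twisted_act m a = of_row (row_mult n (coords m) (\<sigma>t a))"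

lemma carrier: "\<sigma> a \<in> carrier_mat n n" "\<sigma>t a \<in> carrier_mat n n"
  and \<sigma>t_add: "\<sigma>t (a + b) = \<sigma>t a + \<sigma>t b"
  and \<sigma>t_scale: "\<sigma>t (scale c a) = map_mat (scale c) (\<sigma>t a)"
  and \<sigma>t_\<sigma>: "\<sigma>t b * \<sigma> a * idem = \<sigma>t (b * a) * idem"
  and \<sigma>t_one: "\<sigma>t 1 = idem"
  and \<sigma>_idem: "\<sigma> a * idem = idem * \<sigma>t a"
  and idem_idem: "idem * idem = idem"
  using system by (auto simp: pre_projective_system_def linear_to_mat_def)

lemmas carriers = carrier idem_carrier mult_carrier_mat[of _ n n _ n]

text \<open>
  Both sides equal \<open>\<pi> \<sigma>(a) \<pi>\<close>: the left one by \<open>\<sigma>t(1) = \<pi>\<close> and the product rule, the right one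
  by \<open>\<sigma>(a) \<pi> = \<pi> \<sigma>t(a)\<close>.
\<close>

lemma \<sigma>t_idem: "\<sigma>t a * idem = idem * \<sigma>t a"
proof -
  have "\<sigma>t a * idem = idem * \<sigma> a * idem"
    using \<sigma>t_\<sigma>[of 1 a] by (simp add: \<sigma>t_one)
  also have "\<dots> = idem * (idem * \<sigma>t a)"
    by (simp add: assoc_mult_mat[of _ n n _ n _ n] carriers \<sigma>_idem)
  also have "\<dots> = idem * \<sigma>t a"
    by (simp add: assoc_mult_mat[of _ n n _ n _ n, symmetric] carriers idem_idem)
  finally show ?thesis .
qed

lemma mult_idem_idem: "P \<in> carrier_mat n n \<Longrightarrow> P * idem * idem = P * idem"
  by (simp add: assoc_mult_mat[of _ n n _ n _ n] carriers idem_idem)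

lemma twisted_act_expand:
  "twisted_act m a = (\<Sum>i<n. \<Sum>j<n. lact (\<eta> i m * \<sigma>t a $$ (i, j)) (\<omega> j))"
  by (simp add: twisted_act_def of_row_mult_expand)

lemma twisted_act_via_\<sigma>: "twisted_act m a = of_row (row_mult n (coords m) (\<sigma> a))"
  unfolding twisted_act_def by (rule of_row_mult_cong) (simp_all add: carriers \<sigma>_idem \<sigma>t_idem)

lemma twisted_act_generator_\<sigma>t:
  assumes "i < n"
  shows "twisted_act (\<omega> i) a = (\<Sum>j<n. lact (\<sigma>t a $$ (i, j)) (\<omega> j))"
proof -
  have "twisted_act (\<omega> i) a = of_row (\<lambda>j. (idem * \<sigma>t a) $$ (i, j))"
    unfolding twisted_act_def by (rule of_row_coords_generator) (simp_all add: carriers assms)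
  also have "\<dots> = of_row (\<lambda>j. \<sigma>t a $$ (i, j))"
    by (rule of_matrix_row_cong) (simp_all add: carriers assms \<sigma>t_idem[symmetric] mult_idem_idem)
  finally show ?thesis by (simp add: of_row_def)
qed

lemma twisted_act_generator_\<sigma>:
  assumes "i < n"
  shows "twisted_act (\<omega> i) a = (\<Sum>j<n. lact (\<sigma> a $$ (i, j)) (\<omega> j))"
proof -
  have "twisted_act (\<omega> i) a = of_row (\<lambda>j. \<sigma>t a $$ (i, j))"
    by (simp add: twisted_act_generator_\<sigma>t assms of_row_def)
  also have "\<dots> = of_row (\<lambda>j. \<sigma> a $$ (i, j))"
    by (rule of_matrix_row_cong) (simp_all add: carriers assms \<sigma>_idem \<sigma>t_idem)
  finally show ?thesis by (simp add: of_row_def)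
qed

lemma twisted_act_mult: "twisted_act m (a * b) = twisted_act (twisted_act m a) b"
proof -
  let ?v = "row_mult n (coords m) (\<sigma>t a)"
  have "twisted_act (twisted_act m a) b = of_row (row_mult n (row_mult n ?v idem) (\<sigma>t b))"
    unfolding twisted_act_def
    by (intro of_row_cong row_mult_cong) (rule coords_of_row)
  also have "\<dots> = of_row (row_mult n ?v (\<sigma> b * idem))"
    by (rule of_row_cong) (simp add: row_mult_assoc carriers \<sigma>_idem)
  also have "\<dots> = of_row (row_mult n (coords m) (\<sigma>t a * (\<sigma> b * idem)))"
    by (rule of_row_cong) (simp add: row_mult_assoc carriers)
  also have "\<sigma>t a * (\<sigma> b * idem) = \<sigma>t (a * b) * idem"
    by (simp add: \<sigma>t_\<sigma>[symmetric] assoc_mult_mat[of _ n n _ n _ n] carriers)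
  also have "of_row (row_mult n (coords m) \<dots>) = of_row (row_mult n (coords m) (\<sigma>t (a * b)))"
    by (rule of_row_mult_cong)
      (simp_all add: carriers mult_idem_idem)
  finally show ?thesis by (simp add: twisted_act_def)
qed

lemma twisted_act_one: "twisted_act m 1 = m"
  by (simp add: twisted_act_def \<sigma>t_one of_row_mult_idempotent of_row_coords)

lemma twisted_act_lact: "twisted_act (lact a x) b = lact a (twisted_act x b)"
  unfolding twisted_act_def of_row_scale[symmetric] row_mult_scale_left[symmetric]
  by (intro of_row_cong row_mult_cong) (simp add: coords_lact)

lemma twisted_act_scalar: "twisted_act x (scale c 1) = lact (scale c 1) x"
proof -
  have "twisted_act x (scale c 1) = of_row (\<lambda>j. scale c 1 * row_mult n (coords x) idem j)"
    unfolding twisted_act_def \<sigma>t_scale \<sigma>t_one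
  proof (rule of_row_cong)
    fix j assume j: "j < n"
    have "\<eta> i x * scale c y = scale c 1 * (\<eta> i x * y)" for i y
      using scale_mult_right[of c "\<eta> i x" y] scale_mult_left[of c 1 "\<eta> i x * y"] by simp
    then show "row_mult n (coords x) (map_mat (scale c) idem) j =
        scale c 1 * row_mult n (coords x) idem j"
      using j idem_carrier by (simp add: row_mult_def sum_distrib_left)
  qed
  then show ?thesis
    by (simp add: of_row_scale of_row_mult_idempotent of_row_coords)
qed

lemma twisted_act_add_left: "twisted_act (x + y) a = twisted_act x a + twisted_act y a"
  unfolding twisted_act_def of_row_add[symmetric] row_mult_add_left[symmetric]
  by (intro of_row_cong row_mult_cong) (simp add: coords_add)

lemma twisted_act_add_right: "twisted_act x (a + b) = twisted_act x a + twisted_act x b"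
  unfolding twisted_act_def of_row_add[symmetric]
  by (intro of_row_cong) (simp add: \<sigma>t_add row_mult_add_right carriers)

sublocale twisted: bimodule scale lact twisted_act
  by unfold_locales
    (simp_all add: twisted_act_add_left twisted_act_add_right twisted_act_mult twisted_act_one
      twisted_act_lact twisted_act_scalar)

end

section \<open>The right dual basis of a projective system\<close>

locale projective_module = pre_projective_module scale lact n \<omega> \<eta> \<sigma> \<sigma>t
  for scale :: "'k::field \<Rightarrow> 'a::{ring, monoid_mult} \<Rightarrow> 'a"
    and lact :: "'a \<Rightarrow> 'm::ab_group_add \<Rightarrow> 'm"
    and n :: nat and \<omega> :: "nat \<Rightarrow> 'm" and \<eta> :: "nat \<Rightarrow> 'm \<Rightarrow> 'a"
    and \<sigma> \<sigma>t :: "'a \<Rightarrow> 'a mat" +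
  fixes \<sigma>b :: "'a \<Rightarrow> 'a mat"
  assumes projective: "projective_system scale n (dual_basis_idempotent n \<omega> \<eta>) \<sigma> \<sigma>t \<sigma>b"
begin

lemma \<sigma>b_carrier: "\<sigma>b a \<in> carrier_mat n n"
  and \<sigma>b_mult: "\<sigma>b (a * b) = \<sigma>b a * \<sigma>b b"
  and \<sigma>b_\<sigma>t: "i < n \<Longrightarrow> j < n \<Longrightarrow>
    (\<Sum>k<n. \<sigma>b (\<sigma>t a $$ (j, k)) $$ (i, k)) = (if i = j then a else 0)"
  and \<sigma>_\<sigma>b: "i < n \<Longrightarrow> j < n \<Longrightarrow>
    (\<Sum>k<n. \<sigma> (\<sigma>b a $$ (k, i)) $$ (k, j)) = a * idem $$ (i, j)"
  using projective
  by (auto simp: projective_system_def algebra_map_to_mat_def linear_to_mat_def)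

lemma \<sigma>b_index_add:
  assumes "i < n" "j < n"
  shows "\<sigma>b (a + b) $$ (i, j) = \<sigma>b a $$ (i, j) + \<sigma>b b $$ (i, j)"
proof -
  have "\<sigma>b (a + b) = \<sigma>b a + \<sigma>b b"
    using projective by (simp add: projective_system_def algebra_map_to_mat_def linear_to_mat_def)
  then show ?thesis using assms \<sigma>b_carrier[of b] by simp
qed

lemma \<sigma>b_index_sum:
  "i < n \<Longrightarrow> j < n \<Longrightarrow> \<sigma>b (\<Sum>k\<in>I. c k) $$ (i, j) = (\<Sum>k\<in>I. \<sigma>b (c k) $$ (i, j))"
  by (rule additive_sum[of "\<lambda>a. \<sigma>b a $$ (i, j)"]) (rule \<sigma>b_index_add)

lemma lact_generator:
  assumes "i < n"
  shows "lact a (\<omega> i) = (\<Sum>j<n. twisted_act (\<omega> j) (\<sigma>b a $$ (j, i)))"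
proof -
  have "(\<Sum>j<n. twisted_act (\<omega> j) (\<sigma>b a $$ (j, i))) =
      (\<Sum>j<n. \<Sum>k<n. lact (\<sigma> (\<sigma>b a $$ (j, i)) $$ (j, k)) (\<omega> k))"
    by (simp add: twisted_act_generator_\<sigma>)
  also have "\<dots> = (\<Sum>k<n. lact (a * idem $$ (i, k)) (\<omega> k))"
    by (subst sum.swap) (simp add: lact_sum_left[symmetric] \<sigma>_\<sigma>b assms)
  also have "\<dots> = of_row (\<lambda>k. a * \<eta> k (\<omega> i))"
    using assms by (simp add: of_row_def dual_basis_idempotent_def)
  also have "\<dots> = lact a (\<omega> i)"
    by (simp add: of_row_scale of_row_coords)
  finally show ?thesis by simp
qed

definition row_dual :: "nat \<Rightarrow> (nat \<Rightarrow> 'a) \<Rightarrow> 'a" where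
  "row_dual j v = (\<Sum>i<n. \<sigma>b (v i) $$ (j, i))"

lemma row_dual_cong: "(\<And>i. i < n \<Longrightarrow> v i = w i) \<Longrightarrow> row_dual j v = row_dual j w"
  by (simp add: row_dual_def)

text \<open>
  Expanding \<open>\<sigma>b(v\<^sub>k \<sigma>t\<^sub>k\<^sub>i(a))\<close> multiplicatively isolates the inner sum
  \<open>\<Sum>\<^sub>i \<sigma>b\<^sub>p\<^sub>i(\<sigma>t\<^sub>k\<^sub>i(a)) = \<delta>\<^sub>p\<^sub>k a\<close>, which pulls \<open>a\<close> out on the right.
\<close>

lemma row_dual_mult_\<sigma>t:
  assumes j: "j < n"
  shows "row_dual j (row_mult n v (\<sigma>t a)) = row_dual j v * a"
proof -
  have "row_dual j (row_mult n v (\<sigma>t a)) =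
      (\<Sum>i<n. \<Sum>k<n. \<Sum>p<n. \<sigma>b (v k) $$ (j, p) * \<sigma>b (\<sigma>t a $$ (k, i)) $$ (p, i))"
    using j
    by (simp add: row_dual_def row_mult_def \<sigma>b_index_sum \<sigma>b_mult
        index_mult_mat_sum[OF \<sigma>b_carrier \<sigma>b_carrier] del: index_mult_mat)
  also have "\<dots> = (\<Sum>k<n. \<Sum>p<n. \<Sum>i<n. \<sigma>b (v k) $$ (j, p) * \<sigma>b (\<sigma>t a $$ (k, i)) $$ (p, i))"
    by (rule trans[OF sum.swap]) (rule sum.cong[OF refl], rule sum.swap)
  also have "\<dots> = (\<Sum>k<n. \<Sum>p<n. \<sigma>b (v k) $$ (j, p) * (if p = k then a else 0))"
    by (intro sum.cong refl) (simp add: sum_distrib_left[symmetric] \<sigma>b_\<sigma>t)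
  also have "\<dots> = (\<Sum>k<n. \<sigma>b (v k) $$ (j, k) * a)"
    by (intro sum.cong refl) (simp add: if_distrib[of "\<lambda>x. _ * x"] cong: if_cong)
  finally show ?thesis by (simp add: row_dual_def sum_distrib_right)
qed

text \<open>
  The coordinates of \<open>m a\<close> are \<open>\<eta>(m) \<sigma>t(a) \<pi>\<close>; the trailing \<open>\<pi> = \<sigma>t(1)\<close> is absorbed as right
  multiplication by \<open>1\<close>.
\<close>

lemma dual_coord_ract:
  assumes j: "j < n"
  shows "row_dual j (coords (twisted_act m a)) = row_dual j (coords m) * a"
proof -
  have "row_dual j (coords (twisted_act m a)) =
      row_dual j (row_mult n (row_mult n (coords m) (\<sigma>t a)) (\<sigma>t 1))"
    unfolding twisted_act_def \<sigma>t_one by (rule row_dual_cong) (rule coords_of_row)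
  then show ?thesis by (simp add: row_dual_mult_\<sigma>t j)
qed

lemma dual_coord_hom:
  assumes "j < n"
  shows "right_module_hom twisted_act (*) (\<lambda>m. row_dual j (coords m))"
  unfolding right_module_hom_def
  using assms
  by (auto simp: dual_coord_ract) (simp add: row_dual_def coords_add \<sigma>b_index_add sum.distrib)

lemma right_dual_basis_expand:
  "m = (\<Sum>j<n. twisted_act (\<omega> j) (row_dual j (coords m)))"
proof -
  have "m = (\<Sum>i<n. lact (\<eta> i m) (\<omega> i))"
    using of_row_coords[of m] by (simp add: of_row_def)
  also have "\<dots> = (\<Sum>i<n. \<Sum>j<n. twisted_act (\<omega> j) (\<sigma>b (\<eta> i m) $$ (j, i)))"
    by (simp add: lact_generator)
  also have "\<dots> = (\<Sum>j<n. twisted_act (\<omega> j) (row_dual j (coords m)))"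
    by (subst sum.swap) (simp add: row_dual_def twisted.ract_sum_right)
  finally show ?thesis .
qed

end

section \<open>The bimodule of a projective system\<close>

theorem proposition2p4:
  fixes scale :: "'k::field \<Rightarrow> 'a::{ring, monoid_mult} \<Rightarrow> 'a"
    and lact :: "'a \<Rightarrow> 'm::ab_group_add \<Rightarrow> 'm"
    and n :: nat
    and \<omega> :: "nat \<Rightarrow> 'm"
    and \<eta> :: "nat \<Rightarrow> 'm \<Rightarrow> 'a"
    and \<pi> :: "'a mat"
    and \<sigma> \<sigma>t :: "'a \<Rightarrow> 'a mat"
    and ract :: "'m \<Rightarrow> 'a \<Rightarrow> 'm"
  assumes "assoc_algebra scale"
    and "left_module lact"
    and "finite_dual_basis lact n \<omega> \<eta>"
    and "\<pi> = dual_basis_idempotent n \<omega> \<eta>"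
    and "pre_projective_system scale n \<pi> \<sigma> \<sigma>t"
    and "\<And>m a. ract m a = (\<Sum>i<n. \<Sum>j<n. lact (\<eta> i m * \<sigma>t a $$ (i, j)) (\<omega> j))"
  shows
    "((\<forall>m a. ract m a = (\<Sum>i<n. \<Sum>j<n. lact (\<eta> i m * \<sigma> a $$ (i, j)) (\<omega> j))) \<and>
      bimodule scale lact ract \<and>
      (\<forall>a. \<forall>i<n. ract (\<omega> i) a = (\<Sum>j<n. lact (\<sigma> a $$ (i, j)) (\<omega> j)) \<and>
                 ract (\<omega> i) a = (\<Sum>j<n. lact (\<sigma>t a $$ (i, j)) (\<omega> j)))) \<and>
     (\<forall>\<sigma>b. projective_system scale n \<pi> \<sigma> \<sigma>t \<sigma>b \<longrightarrow>
        (\<forall>a. \<forall>i<n. lact a (\<omega> i) = (\<Sum>j<n. ract (\<omega> j) (\<sigma>b a $$ (j, i)))) \<and>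
        right_finitely_generated ract \<and>
        right_projective TYPE('x::ab_group_add) TYPE('y::ab_group_add) ract)"
proof -
  interpret pre_projective_module scale lact n \<omega> \<eta> \<sigma> \<sigma>t
    using assms(1-3,5) unfolding assms(4)
    by (intro pre_projective_module.intro left_dual_basis.intro left_dual_basis_axioms.intro
        pre_projective_module_axioms.intro)
  have ract: "ract = twisted_act"
    by (intro ext) (simp add: assms(6) twisted_act_expand)
  have first: "(\<forall>m a. ract m a = (\<Sum>i<n. \<Sum>j<n. lact (\<eta> i m * \<sigma> a $$ (i, j)) (\<omega> j))) \<and>
      bimodule scale lact ract \<and>
      (\<forall>a. \<forall>i<n. ract (\<omega> i) a = (\<Sum>j<n. lact (\<sigma> a $$ (i, j)) (\<omega> j)) \<and>
                 ract (\<omega> i) a = (\<Sum>j<n. lact (\<sigma>t a $$ (i, j)) (\<omega> j)))"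
    unfolding ract
    by (intro conjI allI impI twisted_act_generator_\<sigma> twisted_act_generator_\<sigma>t
        twisted.bimodule_axioms) (simp_all add: twisted_act_via_\<sigma> of_row_mult_expand)
  have second: "(\<forall>a. \<forall>i<n. lact a (\<omega> i) = (\<Sum>j<n. ract (\<omega> j) (\<sigma>b a $$ (j, i)))) \<and>
      right_finitely_generated ract \<and>
      right_projective TYPE('x::ab_group_add) TYPE('y::ab_group_add) ract"
    if "projective_system scale n \<pi> \<sigma> \<sigma>t \<sigma>b" for \<sigma>b
  proof -
    interpret projective_module scale lact n \<omega> \<eta> \<sigma> \<sigma>t \<sigma>b
      using that unfolding assms(4)
      by (intro projective_module.intro projective_module_axioms.intro pre_projective_module_axioms)
    show ?thesis
      unfolding ract
      by (intro conjI allI impI lact_generator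
          twisted.right_dual_basis_imp_finitely_generated[OF right_dual_basis_expand]
          twisted.right_dual_basis_imp_projective[OF right_dual_basis_expand dual_coord_hom])
  qed
  show ?thesis using first second by blast
qed

end
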